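(* Let $\mathbb{X}$ and $\mathbb{Y}$ be Banach spaces and let $\mathcal{A}:\mathbb{X}\rightrightarrows\mathbb{Y}$ be a set-valued mapping with $\mathcal{A}(0)\neq\emptyset$. Then the following two conditions are equivalent: (a) $\mathcal{A}$ is compactly R-continuous at $0$ and the set $\mathcal{A}(0)$ is closed; (b) the graph of $\mathcal{A}$ is closed at $0$.
   Context: A set-valued mapping $\mathcal{A}:\mathbb{X}\rightrightarrows\mathbb{Y}$ assigns to each $x\in\mathbb{X}$ a (possibly empty) subset $\mathcal{A}(x)\subset\mathbb{Y}$; $\mathrm{dom}\,\mathcal{A}=\{x : \mathcal{A}(x)\neq\emptyset\}$. $\mathbb{B}$ denotes the closed unit ball and $\mathbb{B}(\bar x,\sigma)$ the closed ball with center $\bar x$ and radius $\sigma$. Compact R-continuity: $\mathcal{A}$ is compactly R-continuous at $\bar x\in\mathrm{dom}\,\mathcal{A}$ if for every compact set $K\subset\mathbb{Y}$ there exist $\sigma>0$ and a nondecreasing function $\rho:[0,\infty)\to[0,\infty)$ with $\lim_{r\to0^+}\rho(r)=\rho(0)=0$ such that $\mathcal{A}(x)\cap K\subset\mathcal{A}(\bar x)+\rho(\|x-\bar x\|)\mathbb{B}$ for all $x\in\mathbb{B}(\bar x,\sigma)$. The inclusion means that for each $y\in\mathcal{A}(x)\cap K$ there is $\bar y\in\mathcal{A}(\bar x)$ with $\|y-\bar y\|\le\rho(\|x-\bar x\|)$. Closed graph at a point: the graph of $\mathcal{A}$ is closed at $\bar x\in\mathrm{dom}\,\mathcal{A}$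 if for any sequence $x_k\to\bar x$ and any sequence $y_k\in\mathcal{A}(x_k)$ converging to some $y$, one has $y\in\mathcal{A}(\bar x)$. *)

theory Defs
  imports "HOL-Analysis.Analysis"
begin

definition sv_dom :: "('x \<Rightarrow> 'y set) \<Rightarrow> 'x set" where
  "sv_dom A = {x. A x \<noteq> {}}"

(* A modulus [0,oo) -> [0,oo) is rendered as a total function on the reals of which only the
   values on {0..} are constrained or used. *)
definition compactly_R_continuous_at ::
    "('x::real_normed_vector \<Rightarrow> 'y::real_normed_vector set) \<Rightarrow> 'x \<Rightarrow> bool" where
  "compactly_R_continuous_at A xbar \<longleftrightarrow>
     xbar \<in> sv_dom A \<and>
     (\<forall>K. compact K \<longrightarrow>
        (\<exists>\<sigma>>0. \<exists>\<rho> :: real \<Rightarrow> real.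
           (\<forall>r\<ge>0. \<rho> r \<ge> 0) \<and> mono_on {0..} \<rho> \<and>
           (\<rho> \<longlongrightarrow> 0) (at_right 0) \<and> \<rho> 0 = 0 \<and>
           (\<forall>x \<in> cball xbar \<sigma>. \<forall>y \<in> A x \<inter> K.
              \<exists>ybar \<in> A xbar. norm (y - ybar) \<le> \<rho> (norm (x - xbar)))))"

definition graph_closed_at ::
    "('x::real_normed_vector \<Rightarrow> 'y::real_normed_vector set) \<Rightarrow> 'x \<Rightarrow> bool" where
  "graph_closed_at A xbar \<longleftrightarrow>
     xbar \<in> sv_dom A \<and>
     (\<forall>(x :: nat \<Rightarrow> 'x) (y :: nat \<Rightarrow> 'y) l.
        x \<longlonglongrightarrow> xbar \<longrightarrow> (\<forall>k. y k \<in> A (x k)) \<longrightarrow> y \<longlonglongrightarrow> l \<longrightarrow> l \<in> A xbar)"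

end

theory Submission
  imports Defs
begin

text \<open>Both conditions measure how far points \<open>y \<in> A x \<inter> K\<close> can lie from the set \<open>A xbar\<close>, and
  the link between them is the function \<open>\<lambda>y. infdist y (A xbar)\<close>, which is continuous and, for a
  closed nonempty \<open>A xbar\<close>, vanishes exactly on \<open>A xbar\<close>.

  From R-continuity to the closed graph: a convergent sequence together with its limit is a
  compact set, so the modulus belonging to this set forces \<open>infdist (y k) (A xbar)\<close> to tend to \<open>0\<close>;
  the limit has distance \<open>0\<close> to the closed set \<open>A xbar\<close>.

  From the closed graph to R-continuity: by compactness of \<open>K\<close> the distance
  \<open>infdist y (A xbar)\<close> is uniformly small for \<open>y \<in> A x \<inter> K\<close> and \<open>x\<close> near \<open>xbar\<close>
  (\<open>graph_closed_at_uniformly_close\<close>). Hence the worst such distance over the ball of radius \<open>r\<close>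
  is a nondecreasing function of \<open>r\<close> that tends to \<open>0\<close>. A nearest point of \<open>A xbar\<close> need not
  exist in infinite dimension; twice the worst distance leaves enough room to select a point of
  \<open>A xbar\<close> all the same, and this is the modulus.\<close>

lemma graph_closed_atD:
  assumes "graph_closed_at A xbar" "x \<longlonglongrightarrow> xbar" "\<And>k. y k \<in> A (x k)" "y \<longlonglongrightarrow> l"
  shows "l \<in> A xbar"
proof -
  have "x \<longlonglongrightarrow> xbar \<longrightarrow> (\<forall>k. y k \<in> A (x k)) \<longrightarrow> y \<longlonglongrightarrow> l \<longrightarrow> l \<in> A xbar"
    using assms(1) unfolding graph_closed_at_def by (elim conjE allE)
  then show ?thesis
    using assms(2-4) by simp
qed

lemma graph_closed_at_imp_closed:
  assumes "graph_closed_at A xbar"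
  shows "closed (A xbar)"
  unfolding closed_sequential_limits
proof (intro allI impI)
  fix y l assume y: "(\<forall>n. y n \<in> A xbar) \<and> y \<longlonglongrightarrow> l"
  show "l \<in> A xbar"
  proof (rule graph_closed_atD[OF assms tendsto_const])
    show "y k \<in> A xbar" for k
      using y by simp
    show "y \<longlonglongrightarrow> l"
      using y by simp
  qed
qed

text \<open>The failure of the conclusion would give points of \<open>K\<close> at distance at least \<open>e\<close> from
  \<open>A xbar\<close> over base points converging to \<open>xbar\<close>; a cluster point of them would still have this
  distance, although the closed graph places it in \<open>A xbar\<close>.\<close>

lemma graph_closed_at_uniformly_close:
  assumes gc: "graph_closed_at A xbar" and K: "compact K" and e: "e > 0"
  obtains d where "d > 0"
    "\<And>x y. norm (x - xbar) \<le> d \<Longrightarrow> y \<in> A x \<inter> K \<Longrightarrow> infdist y (A xbar) < e"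
proof (rule ccontr)
  assume "\<not> thesis"
  with that have "\<forall>d>0. \<exists>x y. norm (x - xbar) \<le> d \<and> y \<in> A x \<inter> K \<and> e \<le> infdist y (A xbar)"
    by (meson not_less)
  then have "\<forall>n. \<exists>x y. norm (x - xbar) \<le> 1 / real (Suc n) \<and> y \<in> A x \<inter> K
      \<and> e \<le> infdist y (A xbar)"
    by simp
  then obtain x y where xy: "\<And>n. norm (x n - xbar) \<le> 1 / real (Suc n)"
      "\<And>n. y n \<in> A (x n) \<inter> K" "\<And>n. e \<le> infdist (y n) (A xbar)"
    by metis
  have "(\<lambda>n. x n - xbar) \<longlonglongrightarrow> 0"
    using xy(1) by (intro Lim_null_comparison[OF _ LIMSEQ_Suc[OF lim_1_over_n]] always_eventually allI)
  then have x: "x \<longlonglongrightarrow> xbar"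
    by (rule LIM_zero_cancel)
  obtain l s where s: "strict_mono s" and l: "(y \<circ> s) \<longlonglongrightarrow> l"
  proof (rule seq_compactE[OF K[unfolded compact_eq_seq_compact_metric]])
    show "\<forall>n. y n \<in> K"
      using xy(2) by simp
  qed
  have "l \<in> A xbar"
    by (rule graph_closed_atD[OF gc LIMSEQ_subseq_LIMSEQ[OF x s] _ l])
      (simp add: IntD1[OF xy(2)])
  moreover have "e \<le> infdist l (A xbar)"
  proof (rule tendsto_lowerbound[OF tendsto_infdist[OF l] _ sequentially_bot])
    show "\<forall>\<^sub>F n in sequentially. e \<le> infdist ((y \<circ> s) n) (A xbar)"
      by (rule always_eventually) (simp add: xy(3))
  qed
  ultimately show False
    using e by simp
qed

text \<open>The element \<open>0\<close> is inserted so that the supremum is taken over a nonempty set even when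
  \<open>A x \<inter> K\<close> is empty for all \<open>x\<close> in the ball.\<close>

definition excess ::
    "('x::real_normed_vector \<Rightarrow> 'y::real_normed_vector set) \<Rightarrow> 'x \<Rightarrow> 'y set \<Rightarrow> real \<Rightarrow> real" where
  "excess A xbar K r = Sup (insert 0 {infdist y (A xbar) | x y. norm (x - xbar) \<le> r \<and> y \<in> A x \<inter> K})"

text \<open>Boundedness comes from \<open>K\<close> alone, uniformly in \<open>r\<close>, so the excess is a genuine supremum for
  every radius, and a modulus built from it satisfies the inclusion on a ball of any size.\<close>

lemma bdd_above_excess:
  assumes "compact K"
  shows "bdd_above (insert 0 {infdist y (A xbar) | x y. norm (x - xbar) \<le> r \<and> y \<in> A x \<inter> K})"
proof -
  have "compact ((\<lambda>y. infdist y (A xbar)) ` K)"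
    by (rule compact_continuous_image[OF continuous_on_infdist[OF continuous_on_id] assms])
  then have "bdd_above ((\<lambda>y. infdist y (A xbar)) ` K)"
    by (rule bounded_imp_bdd_above[OF compact_imp_bounded])
  then show ?thesis
    unfolding bdd_above_insert
    by (rule bdd_above_mono) blast
qed

lemma infdist_le_excess:
  assumes "compact K" "norm (x - xbar) \<le> r" "y \<in> A x \<inter> K"
  shows "infdist y (A xbar) \<le> excess A xbar K r"
  unfolding excess_def using assms(2,3)
  by (intro cSup_upper[OF insertI2 bdd_above_excess[OF assms(1)]]) blast

lemma excess_nonneg: "compact K \<Longrightarrow> 0 \<le> excess A xbar K r"
  unfolding excess_def by (rule cSup_upper[OF insertI1 bdd_above_excess])

lemma excess_leI:
  assumes "0 \<le> e" "\<And>x y. norm (x - xbar) \<le> r \<Longrightarrow> y \<in> A x \<inter> K \<Longrightarrow> infdist y (A xbar) \<le> e"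
  shows "excess A xbar K r \<le> e"
  unfolding excess_def using assms by (intro cSup_least) auto

lemma excess_mono:
  assumes K: "compact K" and "r \<le> s"
  shows "excess A xbar K r \<le> excess A xbar K s"
proof (rule excess_leI)
  fix x y assume "norm (x - xbar) \<le> r" "y \<in> A x \<inter> K"
  then show "infdist y (A xbar) \<le> excess A xbar K s"
    using \<open>r \<le> s\<close> by (intro infdist_le_excess[OF K, of x]) simp_all
qed (rule excess_nonneg[OF K])

lemma excess_0:
  assumes "compact K"
  shows "excess A xbar K 0 = 0"
  using assms by (intro antisym excess_leI excess_nonneg) auto

lemma excess_tendsto_0:
  assumes gc: "graph_closed_at A xbar" and K: "compact K"
  shows "(excess A xbar K \<longlongrightarrow> 0) (at_right 0)"
proof (rule tendstoI)
  fix e :: real assume "e > 0"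
  then have "e / 2 > 0" by simp
  from gc K this obtain d where d: "d > 0"
      "\<And>x y. norm (x - xbar) \<le> d \<Longrightarrow> y \<in> A x \<inter> K \<Longrightarrow> infdist y (A xbar) < e / 2"
    by (rule graph_closed_at_uniformly_close) blast
  have "dist (excess A xbar K r) 0 < e" if "r < d" for r
  proof -
    have "excess A xbar K r \<le> excess A xbar K d"
      using K that by (intro excess_mono) auto
    also have "\<dots> \<le> e / 2"
      using \<open>e / 2 > 0\<close> d(2) by (intro excess_leI less_imp_le)
    finally show ?thesis
      using excess_nonneg[OF K, of A xbar r] \<open>e > 0\<close> by simp
  qed
  with \<open>d > 0\<close> show "\<forall>\<^sub>F r in at_right 0. dist (excess A xbar K r) 0 < e"
    unfolding eventually_at_right_field by blast
qed

text \<open>The factor \<open>2\<close> makes up for a distance that is not attained. When the distance is \<open>0\<close>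
  the factor gives no room, and closedness of \<open>S\<close> makes \<open>y\<close> itself the witness.\<close>

lemma closed_obtain_nearly_nearest:
  fixes S :: "'y::real_normed_vector set"
  assumes "closed S" "S \<noteq> {}"
  obtains z where "z \<in> S" "norm (y - z) \<le> 2 * infdist y S"
proof (cases "infdist y S = 0")
  case True
  then have "y \<in> S"
    using assms in_closed_iff_infdist_zero by blast
  then show ?thesis
    using that True by simp
next
  case False
  then have "infdist y S < 2 * infdist y S"
    using infdist_nonneg[of y S] by linarith
  then obtain z where "z \<in> S" "dist y z < 2 * infdist y S"
    using assms(2) by (auto simp: infdist_notempty cINF_less_iff)
  then show ?thesis
    using that by (simp add: dist_norm)
qed

lemma graph_closed_at_imp_compactly_R_continuous_at:
  assumes gc: "graph_closed_at A xbar"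
  shows "compactly_R_continuous_at A xbar"
  unfolding compactly_R_continuous_at_def
proof (intro conjI allI impI)
  show dom: "xbar \<in> sv_dom A"
    using gc by (simp add: graph_closed_at_def)
  fix K :: "'b set" assume K: "compact K"
  let ?\<rho> = "\<lambda>r. 2 * excess A xbar K r"
  show "\<exists>\<sigma>>0. \<exists>\<rho> :: real \<Rightarrow> real.
           (\<forall>r\<ge>0. \<rho> r \<ge> 0) \<and> mono_on {0..} \<rho> \<and>
           (\<rho> \<longlongrightarrow> 0) (at_right 0) \<and> \<rho> 0 = 0 \<and>
           (\<forall>x \<in> cball xbar \<sigma>. \<forall>y \<in> A x \<inter> K.
              \<exists>ybar \<in> A xbar. norm (y - ybar) \<le> \<rho> (norm (x - xbar)))"
  proof (intro exI[of _ "1::real"] exI[of _ ?\<rho>] conjI allI impI ballI)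
    show "(0::real) < 1"
      by simp
    show "0 \<le> ?\<rho> r" for r
      using K by (simp add: excess_nonneg)
    show "mono_on {0..} ?\<rho>"
      using K by (intro mono_onI) (simp add: excess_mono)
    show "(?\<rho> \<longlongrightarrow> 0) (at_right 0)"
      using tendsto_mult_right_zero[OF excess_tendsto_0[OF gc K]] .
    show "?\<rho> 0 = 0"
      using K by (simp add: excess_0)
  next
    fix x y assume y: "y \<in> A x \<inter> K"
    have "A xbar \<noteq> {}"
      using dom by (simp add: sv_dom_def)
    then obtain z where z: "z \<in> A xbar" "norm (y - z) \<le> 2 * infdist y (A xbar)"
      by (rule closed_obtain_nearly_nearest[OF graph_closed_at_imp_closed[OF gc]])
    have "infdist y (A xbar) \<le> excess A xbar K (norm (x - xbar))"
      using K order_refl y by (rule infdist_le_excess)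
    with z(2) have "norm (y - z) \<le> ?\<rho> (norm (x - xbar))"
      by linarith
    with z(1) show "\<exists>ybar \<in> A xbar. norm (y - ybar) \<le> ?\<rho> (norm (x - xbar))"
      by (rule bexI[rotated])
  qed
qed

lemma compactly_R_continuous_atE:
  assumes "compactly_R_continuous_at A xbar" "compact K"
  obtains \<sigma> \<rho> where "\<sigma> > 0" "(\<rho> \<longlongrightarrow> 0) (at_right (0::real))" "\<rho> 0 = (0::real)"
    "\<forall>x \<in> cball xbar \<sigma>. \<forall>y \<in> A x \<inter> K. \<exists>ybar \<in> A xbar. norm (y - ybar) \<le> \<rho> (norm (x - xbar))"
  using assms(1)[unfolded compactly_R_continuous_at_def, THEN conjunct2, THEN spec, THEN mp, OF assms(2)]
  by (elim exE conjE)

lemma compactly_R_continuous_at_imp_graph_closed_at: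
  assumes R: "compactly_R_continuous_at A xbar" and cl: "closed (A xbar)"
  shows "graph_closed_at A xbar"
  unfolding graph_closed_at_def
proof (intro conjI allI impI)
  show dom: "xbar \<in> sv_dom A"
    using R by (simp add: compactly_R_continuous_at_def)
  fix x y l
  assume x: "x \<longlonglongrightarrow> xbar" and yA: "\<forall>k. y k \<in> A (x k)" and y: "y \<longlonglongrightarrow> l"
  have "compact (insert l (range y))"
    using compactin_sequence_with_limit[of euclidean y l "range y"] y by simp
  with R obtain \<sigma> \<rho> where \<sigma>: "\<sigma> > 0" and \<rho>: "(\<rho> \<longlongrightarrow> 0) (at_right 0)" "\<rho> 0 = 0"
    and incl: "\<forall>x' \<in> cball xbar \<sigma>. \<forall>y' \<in> A x' \<inter> insert l (range y).
      \<exists>ybar \<in> A xbar. norm (y' - ybar) \<le> \<rho> (norm (x' - xbar))"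
    by (rule compactly_R_continuous_atE)
  \<comment> \<open>Some \<open>x k\<close> may equal \<open>xbar\<close>, so the one-sided limit of \<open>\<rho>\<close> at \<open>0\<close> has to be combined
      with its value there.\<close>
  have "(\<lambda>k. \<rho> (norm (x k - xbar))) \<longlonglongrightarrow> 0"
  proof (rule tendstoI)
    fix e :: real assume e: "e > 0"
    then obtain d where d: "d > 0" "\<And>r. 0 < r \<Longrightarrow> r < d \<Longrightarrow> dist (\<rho> r) 0 < e"
      using tendstoD[OF \<rho>(1)] unfolding eventually_at_right_field by blast
    have "dist (\<rho> (norm (x k - xbar))) 0 < e" if "dist (x k) xbar < d" for k
      using that d(2) e \<rho>(2) by (cases "x k = xbar") (auto simp: dist_norm)
    with tendstoD[OF x d(1)]
    show "\<forall>\<^sub>F k in sequentially. dist (\<rho> (norm (x k - xbar))) 0 < e"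
      by (auto elim: eventually_mono)
  qed
  moreover have "\<forall>\<^sub>F k in sequentially. infdist (y k) (A xbar) \<le> \<rho> (norm (x k - xbar))"
    using tendstoD[OF x \<sigma>]
  proof (rule eventually_mono)
    fix k assume "dist (x k) xbar < \<sigma>"
    then have "x k \<in> cball xbar \<sigma>" "y k \<in> A (x k) \<inter> insert l (range y)"
      using yA by (simp_all add: dist_commute)
    with incl obtain z where "z \<in> A xbar" "norm (y k - z) \<le> \<rho> (norm (x k - xbar))"
      by blast
    then show "infdist (y k) (A xbar) \<le> \<rho> (norm (x k - xbar))"
      by (intro infdist_le2) (simp_all add: dist_norm)
  qed
  ultimately have "infdist l (A xbar) \<le> 0"
    using tendsto_infdist[OF y, of "A xbar"] by (intro tendsto_le[OF sequentially_bot])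
  then have "infdist l (A xbar) = 0"
    using infdist_nonneg[of l "A xbar"] by linarith
  then show "l \<in> A xbar"
    using dom cl in_closed_iff_infdist_zero by (auto simp: sv_dom_def)
qed

theorem theorem2:
  fixes A :: "'x::banach \<Rightarrow> 'y::banach set"
  assumes "A 0 \<noteq> {}"
  shows "compactly_R_continuous_at A 0 \<and> closed (A 0) \<longleftrightarrow> graph_closed_at A 0"
  using compactly_R_continuous_at_imp_graph_closed_at graph_closed_at_imp_closed
    graph_closed_at_imp_compactly_R_continuous_at by blast

end
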